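(* Let $M\ge1$, $P_p>0$, $P_{int}>0$, $\sigma_s^2>0$, $0<\eta\le1$, and let $h_{ss}^i,h_{ps}^i,h_{sp}^i>0$ for $i=1,\dots,M$. Put $\zeta_i=\dfrac{h_{ss}^i\,\eta P_p}{\sigma_s^2+h_{ps}^iP_p}$. Consider the problem $$\max_{\alpha\in\mathbb{R}^M}\ \sum_{i=1}^M\alpha_i\log_2\Big(1+\frac{1-\alpha_i}{\alpha_i}\,\zeta_i\Big)\quad\text{subject to}\quad h_{sp}^i(1-\alpha_i)\eta P_p\le\alpha_iP_{int},\quad 0<\alpha_i<1,\quad i=1,\dots,M.$$ Then for each $i$ the equation $$z\ln z-z-\zeta_i+1=0$$ has a unique solution $z_i^*$ with $z_i^*>1$, and the optimal solution $\alpha^*$ of the problem is given by $$\alpha_i^*=\max\left\{\frac{\zeta_i}{\zeta_i+z_i^*-1},\ \frac{h_{sp}^i\eta P_p}{P_{int}+h_{sp}^i\eta P_p}\right\},\qquad i=1,\dots,M.$$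
   Context: Interpretation (online myopic policy): in slot $i$ (of unit length) a secondary transmitter harvests energy for a fraction $1-\alpha_i$ of the slot from a primary transmitter of power $P_p$ with efficiency $\eta$, and spends all of that harvested energy, $(1-\alpha_i)\eta P_p$, transmitting during the remaining fraction $\alpha_i$ of the same slot. The $h$'s are channel power gains, $\sigma_s^2$ is the noise variance, and the first constraint bounds the interference at the primary receiver by $P_{int}$. *)

theory Defs
  imports "HOL-Analysis.Analysis"
begin

text \<open>
  The slots are indexed by a finite type \<open>'m\<close>, so that M = \<open>CARD('m)\<close> (at least 1, since types
  are inhabited) and a policy is a vector of type \<open>real ^ 'm\<close>.  The parameter \<open>\<sigma>\<^sub>s\<close> is the standard
  deviation of the noise; only its square, the noise variance, occurs.
\<close>

definition zeta :: "real \<Rightarrow> real \<Rightarrow> real \<Rightarrow> real \<Rightarrow> real \<Rightarrow> real" where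
  "zeta P\<^sub>p \<sigma>\<^sub>s \<eta> h\<^sub>s\<^sub>s h\<^sub>p\<^sub>s = h\<^sub>s\<^sub>s * \<eta> * P\<^sub>p / (\<sigma>\<^sub>s\<^sup>2 + h\<^sub>p\<^sub>s * P\<^sub>p)"

definition sum_rate :: "('m::finite \<Rightarrow> real) \<Rightarrow> real ^ 'm \<Rightarrow> real" where
  "sum_rate \<zeta> \<alpha> = (\<Sum>i\<in>UNIV. \<alpha> $ i * log 2 (1 + (1 - \<alpha> $ i) / \<alpha> $ i * \<zeta> i))"

definition feasible :: "real \<Rightarrow> real \<Rightarrow> real \<Rightarrow> ('m::finite \<Rightarrow> real) \<Rightarrow> real ^ 'm \<Rightarrow> bool" where
  "feasible P\<^sub>p P\<^sub>i\<^sub>n\<^sub>t \<eta> h\<^sub>s\<^sub>p \<alpha> \<longleftrightarrow>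
     (\<forall>i. h\<^sub>s\<^sub>p i * (1 - \<alpha> $ i) * \<eta> * P\<^sub>p \<le> \<alpha> $ i * P\<^sub>i\<^sub>n\<^sub>t \<and> 0 < \<alpha> $ i \<and> \<alpha> $ i < 1)"

end

theory Submission
  imports Defs
begin

text \<open>
  The problem separates over the slots. For one slot put \<open>u(a) = 1 + (1 - a) / a * c\<close>, so that
  \<open>a * u(a) = a + (1 - a) * c\<close> is affine in \<open>a\<close>. Bounding \<open>ln\<close> by its tangent at \<open>u(m)\<close> therefore
  bounds the rate \<open>a * ln (u(a))\<close> by an affine function of \<open>a\<close> which agrees with it at \<open>m\<close> and whose
  slope has the sign of \<open>u ln u - u - c + 1\<close> at \<open>u = u(m)\<close>. The slope vanishes if \<open>u(m)\<close> is the root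
  \<open>z\<close>, and it is at most 0 if \<open>m\<close> lies to the right of that point, as \<open>u ln u - u\<close> increases.
\<close>

lemma ln_less_minus_one:
  fixes x :: real
  assumes "x > 0" "x \<noteq> 1"
  shows "ln x < x - 1"
  using ln_le_minus_one[of x] ln_eq_minus_one[of x] assms by linarith

lemma ln_less_tangent:
  fixes u v :: real
  assumes "u > 0" "v > 0" "u \<noteq> v"
  shows "ln u < ln v + u / v - 1"
  using ln_less_minus_one[of "u / v"] assms by (simp add: ln_div)

text \<open>The tangent bound for \<open>ln\<close> at \<open>v\<close>, multiplied by
  \<open>v\<close>, gives \<open>v * ln u - u < v * ln v - v\<close>. Since \<open>1 \<le> u\<close>
  makes \<open>ln u\<close> nonnegative, the factor \<open>v\<close> on the left may be lowered to
  \<open>u\<close>.\<close>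

lemma mult_ln_minus_strict_mono:
  fixes u v :: real
  assumes "1 \<le> u" "u < v"
  shows "u * ln u - u < v * ln v - v"
proof -
  have "v * ln u < v * (ln v + u / v - 1)"
    using ln_less_tangent[of u v] assms by (intro mult_strict_left_mono) auto
  also have "\<dots> = v * ln v + u - v"
    using assms by (simp add: field_simps)
  finally have "v * ln u < v * ln v + u - v" .
  moreover have "u * ln u \<le> v * ln u"
    using assms by (intro mult_right_mono) auto
  ultimately show ?thesis by linarith
qed

lemma ex1_mult_ln_root:
  fixes c :: real
  assumes "c > 0"
  shows "\<exists>!z. z > 1 \<and> z * ln z - z - c + 1 = 0"
proof -
  let ?f = "\<lambda>z::real. z * ln z - z - c + 1"
  \<comment> \<open>At \<open>exp (1 + c)\<close> the logarithm is \<open>1 + c\<close>, so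
    \<open>?f\<close> equals \<open>c * exp (1 + c) - c + 1\<close> there; at 1 it equals
    \<open>- c\<close>. The root lies in between.\<close>
  have "c * 1 \<le> c * exp (1 + c)"
    using assms by (intro mult_left_mono) auto
  then have "0 \<le> ?f (exp (1 + c))"
    by (simp add: algebra_simps)
  moreover have "continuous_on {1..exp (1 + c)} ?f"
    by (intro continuous_intros) auto
  ultimately obtain z where z: "1 \<le> z" "?f z = 0"
    using IVT'[of ?f 1 0 "exp (1 + c)"] assms by auto
  have "z \<noteq> 1" using z assms by auto
  with z have "z > 1 \<and> ?f z = 0" by simp
  moreover have "y = z" if "y > 1 \<and> ?f y = 0" for y
    using mult_ln_minus_strict_mono[of y z] mult_ln_minus_strict_mono[of z y] that z
    by (cases y z rule: linorder_cases) auto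
  ultimately show ?thesis by blast
qed

text \<open>Here \<open>b\<close> stands for the lower bound that the interference constraint puts
  on the slot. The inequality is strict so that it also yields uniqueness of the optimal
  policy.\<close>

lemma slot_rate_less:
  fixes a b c z :: real
  assumes c: "c > 0" and z: "z > 1" "z * ln z - z - c + 1 = 0"
    and b: "b < 1" and a: "0 < a" "b \<le> a" "a < 1"
    and m_def: "m = max (c / (c + z - 1)) b" and ne: "a \<noteq> m"
  shows "a * log 2 (1 + (1 - a) / a * c) < m * log 2 (1 + (1 - m) / m * c)"
proof -
  define s where "s = c / (c + z - 1)"
  define u where "u = (\<lambda>t::real. 1 + (1 - t) / t * c)"
  have s: "0 < s" "s < 1"
    using c z by (auto simp: s_def field_simps)
  have m: "0 < m" "m < 1" "s \<le> m"
    using s b m_def by (auto simp: s_def)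
  have u_gt: "1 < u t" if "0 < t" "t < 1" for t
    using that c by (simp add: u_def)
  have tu: "t * u t = t + (1 - t) * c" if "0 < t" for t
    using that by (simp add: u_def field_simps)
  have u_alt: "u t = 1 - c + c / t" if "0 < t" for t
    using that by (simp add: u_def field_simps)
  \<comment> \<open>The unconstrained candidate \<open>s\<close> is the solution of
    \<open>u s = z\<close>: \<open>c / s\<close> is \<open>c + z - 1\<close>.\<close>
  have u_s: "u s = z"
    using c s by (simp add: u_alt) (simp add: s_def)
  have um: "1 < u m" and ua: "1 < u a"
    using u_gt m a by auto
  have "u a \<noteq> u m"
    using ne a m c by (simp add: u_alt field_simps)
  then have "a * ln (u a) < a * (ln (u m) + u a / u m - 1)"
    using a um ua by (intro mult_strict_left_mono ln_less_tangent) auto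
  also have "\<dots> = a * (ln (u m) - 1) + (a * u a) / u m"
    by (simp add: algebra_simps)
  \<comment> \<open>As \<open>t * u t\<close> is affine with slope \<open>1 - c\<close>, the bound
    has slope \<open>ln (u m) - 1 + (1 - c) / u m\<close> in \<open>a\<close>.\<close>
  also have "\<dots> = m * ln (u m) + (a - m) * ((u m * ln (u m) - u m - c + 1) / u m)"
  proof -
    have "a * u a = m * u m + (a - m) * (1 - c)"
      unfolding tu[OF a(1)] tu[OF m(1)] by (simp add: algebra_simps)
    then show ?thesis
      using um by (simp add: field_simps)
  qed
  also have "\<dots> \<le> m * ln (u m)"
  proof (cases "m = s")
    case True
    then show ?thesis using u_s z by simp
  next
    case False
    \<comment> \<open>Now \<open>m\<close> is the bound \<open>b\<close>, so every admissible
      \<open>a\<close> lies on its right, and \<open>u m < z\<close> because \<open>u\<close>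
      decreases.\<close>
    then have "s < m" "m \<le> a"
      using m a m_def by (auto simp: s_def)
    have "u m < z"
      using \<open>s < m\<close> s m c by (simp add: u_alt divide_strict_left_mono flip: u_s)
    then have "u m * ln (u m) - u m - c + 1 \<le> 0"
      using mult_ln_minus_strict_mono[of "u m" z] um z by linarith
    then show ?thesis
      using \<open>m \<le> a\<close> um by (simp add: mult_nonneg_nonpos divide_nonpos_pos)
  qed
  finally have "a * ln (u a) < m * ln (u m)" .
  then show ?thesis
    by (simp add: u_def log_def divide_strict_right_mono)
qed

text \<open>The constraints do not couple the coordinates. A feasible vector other than
  \<open>opt\<close> loses strictly in some coordinate and gains in none.\<close>

lemma sum_is_arg_max_iff:
  fixes g :: "'m::finite \<Rightarrow> real \<Rightarrow> real" and opt :: "real ^ 'm"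
  assumes opt: "\<And>i. P i (opt $ i)"
    and less: "\<And>i a. P i a \<Longrightarrow> a \<noteq> opt $ i \<Longrightarrow> g i a < g i (opt $ i)"
  shows "is_arg_max (\<lambda>\<alpha>. \<Sum>i\<in>UNIV. g i (\<alpha> $ i)) (\<lambda>\<alpha>. \<forall>i. P i (\<alpha> $ i)) \<alpha> \<longleftrightarrow> \<alpha> = opt"
proof -
  have *: "(\<Sum>i\<in>UNIV. g i (\<beta> $ i)) < (\<Sum>i\<in>UNIV. g i (opt $ i))"
    if \<beta>: "\<forall>i. P i (\<beta> $ i)" and "\<beta> \<noteq> opt" for \<beta>
  proof (rule sum_strict_mono_ex1)
    show "\<forall>i\<in>UNIV. g i (\<beta> $ i) \<le> g i (opt $ i)"
      using \<beta> less by (metis less_eq_real_def)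
    show "\<exists>i\<in>UNIV. g i (\<beta> $ i) < g i (opt $ i)"
      using \<beta> less \<open>\<beta> \<noteq> opt\<close> by (auto simp: vec_eq_iff)
  qed simp
  show ?thesis
    using * opt unfolding is_arg_max_def by (metis less_asym less_irrefl)
qed

theorem mainTheorem2:
  fixes P\<^sub>p P\<^sub>i\<^sub>n\<^sub>t \<sigma>\<^sub>s \<eta> :: real
    and h\<^sub>s\<^sub>s h\<^sub>p\<^sub>s h\<^sub>s\<^sub>p \<zeta> :: "'m::finite \<Rightarrow> real"
  assumes "P\<^sub>p > 0" and "P\<^sub>i\<^sub>n\<^sub>t > 0" and "\<sigma>\<^sub>s\<^sup>2 > 0" and "0 < \<eta>" and "\<eta> \<le> 1"
    and "\<And>i. h\<^sub>s\<^sub>s i > 0" and "\<And>i. h\<^sub>p\<^sub>s i > 0" and "\<And>i. h\<^sub>s\<^sub>p i > 0"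
    and "\<And>i. \<zeta> i = zeta P\<^sub>p \<sigma>\<^sub>s \<eta> (h\<^sub>s\<^sub>s i) (h\<^sub>p\<^sub>s i)"
  shows "(\<forall>i. \<exists>!z. z > 1 \<and> z * ln z - z - \<zeta> i + 1 = 0) \<and>
    (\<forall>z. (\<forall>i. z i > 1 \<and> z i * ln (z i) - z i - \<zeta> i + 1 = 0) \<longrightarrow>
      (\<forall>\<alpha>. is_arg_max (sum_rate \<zeta>) (feasible P\<^sub>p P\<^sub>i\<^sub>n\<^sub>t \<eta> h\<^sub>s\<^sub>p) \<alpha> \<longleftrightarrow>
        (\<forall>i. \<alpha> $ i = max (\<zeta> i / (\<zeta> i + z i - 1))
                        (h\<^sub>s\<^sub>p i * \<eta> * P\<^sub>p / (P\<^sub>i\<^sub>n\<^sub>t + h\<^sub>s\<^sub>p i * \<eta> * P\<^sub>p)))))"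
proof -
  define b where "b = (\<lambda>i. h\<^sub>s\<^sub>p i * \<eta> * P\<^sub>p / (P\<^sub>i\<^sub>n\<^sub>t + h\<^sub>s\<^sub>p i * \<eta> * P\<^sub>p))"
  have \<zeta>_pos: "\<zeta> i > 0" for i
    using assms by (simp add: zeta_def add_pos_pos)
  have num_pos: "h\<^sub>s\<^sub>p i * \<eta> * P\<^sub>p > 0" for i
    using assms by simp
  have b: "0 < b i" "b i < 1" for i
    using num_pos[of i] \<open>P\<^sub>i\<^sub>n\<^sub>t > 0\<close> by (auto simp: b_def)
  \<comment> \<open>The constraint is linear in \<open>a\<close>; \<open>b i\<close> is the value at
    which it holds with equality.\<close>
  have interference_iff: "h\<^sub>s\<^sub>p i * (1 - a) * \<eta> * P\<^sub>p \<le> a * P\<^sub>i\<^sub>n\<^sub>t \<longleftrightarrow> b i \<le> a" for i a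
    using num_pos[of i] \<open>P\<^sub>i\<^sub>n\<^sub>t > 0\<close> by (simp add: b_def pos_divide_le_eq algebra_simps)
  have feasible_eq: "feasible P\<^sub>p P\<^sub>i\<^sub>n\<^sub>t \<eta> h\<^sub>s\<^sub>p = (\<lambda>\<alpha>. \<forall>i. b i \<le> \<alpha> $ i \<and> 0 < \<alpha> $ i \<and> \<alpha> $ i < 1)"
    by (simp add: fun_eq_iff feasible_def interference_iff)
  have "is_arg_max (sum_rate \<zeta>) (feasible P\<^sub>p P\<^sub>i\<^sub>n\<^sub>t \<eta> h\<^sub>s\<^sub>p) \<alpha> \<longleftrightarrow>
      (\<forall>i. \<alpha> $ i = max (\<zeta> i / (\<zeta> i + z i - 1)) (b i))"
    if z: "\<forall>i. z i > 1 \<and> z i * ln (z i) - z i - \<zeta> i + 1 = 0" for z \<alpha>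
  proof -
    define opt :: "real ^ 'm" where "opt = (\<chi> i. max (\<zeta> i / (\<zeta> i + z i - 1)) (b i))"
    have "is_arg_max (sum_rate \<zeta>) (feasible P\<^sub>p P\<^sub>i\<^sub>n\<^sub>t \<eta> h\<^sub>s\<^sub>p) \<alpha> \<longleftrightarrow> \<alpha> = opt"
      unfolding feasible_eq sum_rate_def[abs_def]
    proof (rule sum_is_arg_max_iff)
      fix i
      \<comment> \<open>The feasible set excludes 1, so the maximum is attained only because
        \<open>z i > 1\<close> keeps this candidate below 1.\<close>
      have "\<zeta> i / (\<zeta> i + z i - 1) < 1"
        using \<zeta>_pos[of i] z[rule_format, of i] by (simp add: field_simps)
      then show "b i \<le> opt $ i \<and> 0 < opt $ i \<and> opt $ i < 1"
        using b[of i] by (auto simp: opt_def)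
    next
      fix i a
      assume "b i \<le> a \<and> 0 < a \<and> a < 1" "a \<noteq> opt $ i"
      then show "a * log 2 (1 + (1 - a) / a * \<zeta> i)
          < opt $ i * log 2 (1 + (1 - opt $ i) / opt $ i * \<zeta> i)"
        using slot_rate_less[OF \<zeta>_pos, of "z i" i "b i" a "opt $ i"] z b by (simp add: opt_def)
    qed
    then show ?thesis
      by (simp add: vec_eq_iff opt_def)
  qed
  then show ?thesis
    using ex1_mult_ln_root[OF \<zeta>_pos] by (simp add: b_def)
qed

end
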